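(* Let $N$ and $M$ be positive integers and $s$ a number with $0<s<1$ such that $$\frac{N}{M^2}=\frac{3-s^2}{(1+s)^2}.$$ Let $(a,b,c)$ be positive integers with no common factor such that $s=a/c$, $c$ divides $a^2$, and $b=c-a^2/c$ (so the angles $(\alpha,\beta,\gamma)$ of the triangle with sides $(a,b,c)$ satisfy $3\alpha+2\beta=\pi$), and let $ABC$ be an isosceles triangle with base angles $\beta$, scaled so that its area is equal to $N$ times the area of the tile $(a,b,c)$. Suppose in addition that $a+c$ divides $M$, or equivalently that $g=\gcd(a,c)$ divides $M$. Then there exists an $N$-tiling of $ABC$ by $(a,b,c)$.
   Context: An $N$-tiling of a triangle $ABC$ by a triangle $T$ (the tile) is a way of writing $ABC$ as a union of $N$ triangles congruent to $T$ (reflections allowed) overlapping only at their boundaries; tiles need not meet edge-to-edge. The angles $\alpha,\beta,\gamma$ of the tile are opposite its sides $a,b,c$ respectively. *)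

theory Defs
  imports "HOL-Analysis.Analysis"
begin

definition triangle :: "real^2 \<Rightarrow> real^2 \<Rightarrow> real^2 \<Rightarrow> (real^2) set" where
  "triangle A B C = convex hull {A, B, C}"

text \<open>The angle at the middle point \<open>Q\<close>; only meaningful for \<open>P \<noteq> Q\<close> and \<open>R \<noteq> Q\<close>.\<close>

definition vertex_angle :: "real^2 \<Rightarrow> real^2 \<Rightarrow> real^2 \<Rightarrow> real" where
  "vertex_angle P Q R = arccos (((P - Q) \<bullet> (R - Q)) / (norm (P - Q) * norm (R - Q)))"

text \<open>Isometries of the plane need not preserve orientation, so reflected copies are congruent.\<close>

definition congruent_sets :: "(real^2) set \<Rightarrow> (real^2) set \<Rightarrow> bool" where
  "congruent_sets S T \<longleftrightarrow> (\<exists>f. (\<forall>x y. dist (f x) (f y) = dist x y) \<and> f ` S = T)"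

text \<open>No edge-to-edge condition is imposed: a vertex of one tile may lie inside an edge of another.\<close>

definition tiling :: "nat \<Rightarrow> (real^2) set \<Rightarrow> (real^2) set \<Rightarrow> (real^2) set set \<Rightarrow> bool" where
  "tiling N X T \<T> \<longleftrightarrow>
     finite \<T> \<and> card \<T> = N \<and>
     (\<forall>S\<in>\<T>. congruent_sets T S) \<and>
     \<Union>\<T> = X \<and>
     (\<forall>S\<in>\<T>. \<forall>S'\<in>\<T>. S \<noteq> S' \<longrightarrow> S \<inter> S' \<subseteq> frontier S \<inter> frontier S')"

end

theory Submission
  imports Defs
begin

text \<open>Put \<open>J = M / (a + c)\<close>. Comparing areas, \<open>ABC\<close> has legs \<open>c\<^sup>2J\<close> and base \<open>a(2c + b)J\<close>, and
\<open>N = (3c\<^sup>2 - a\<^sup>2)J\<^sup>2\<close>. It is cut into four triangles similar to the tile, with ratios \<open>cJ\<close>, \<open>bJ\<close>,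
\<open>aJ\<close>, \<open>bJ\<close>, and one parallelogram with sides \<open>(c - b)J\<close> times \<open>c\<close> and \<open>bJ\<close> times \<open>b\<close>; each piece
is covered by tiles of a lattice. It suffices to cover \<open>ABC\<close> by \<open>N\<close> copies of the tile, since the area
leaves no room for overlaps.

For the divisibility claim, \<open>c dvd a\<^sup>2\<close> forces \<open>(a, b, c) = (km, k\<^sup>2 - m\<^sup>2, k\<^sup>2)\<close> with \<open>k = gcd a c\<close>
coprime to \<open>m\<close>, so that \<open>a + c = k(k + m)\<close>; the formula for \<open>N\<close> already makes \<open>k + m\<close> divide \<open>M\<close>.\<close>

section \<open>Splitting, congruence and area of triangles\<close>

text \<open>The line \<open>AD\<close> separates the pieces: for weights \<open>u\<close>,
  \<open>v\<close>, \<open>w\<close> the sign of \<open>t * v - (1 - t) * w\<close> decides the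
  side, and writing \<open>C\<close> or \<open>B\<close> through \<open>D\<close> then gives
  nonnegative weights.\<close>

lemma split_triangle:
  assumes "D \<in> closed_segment B C"
  shows "triangle A B C = triangle A B D \<union> triangle A D C"
proof -
  obtain t where t: "0 \<le> t" "t \<le> 1" and D: "D = (1 - t) *\<^sub>R B + t *\<^sub>R C"
    using assms by (auto simp: in_segment)
  have "triangle A B C \<subseteq> triangle A B D \<union> triangle A D C"
  proof
    fix p assume "p \<in> triangle A B C"
    then obtain u v w where uvw: "0 \<le> u" "0 \<le> v" "0 \<le> w" "u + v + w = 1"
      and p: "p = u *\<^sub>R A + v *\<^sub>R B + w *\<^sub>R C"
      unfolding triangle_def convex_hull_3 by blast
    show "p \<in> triangle A B D \<union> triangle A D C"
    proof (cases "t * v \<ge> (1 - t) * w")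
      case True
      show ?thesis
      proof (cases "t = 0")
        case True
        \<comment> \<open>Now \<open>D = B\<close>, so \<open>C\<close> cannot be written through
          \<open>D\<close>, but the weight of \<open>C\<close> vanishes.\<close>
        then have "w = 0" using \<open>t * v \<ge> (1 - t) * w\<close> uvw by simp
        then show ?thesis unfolding triangle_def convex_hull_3
          using uvw p by (intro UnI1 CollectI exI[of _ u] exI[of _ v] exI[of _ 0]) auto
      next
        case False
        have "v - w * (1 - t) / t = (t * v - (1 - t) * w) / t" using False by (simp add: field_simps)
        with True t False have nn: "v - w * (1 - t) / t \<ge> 0" by simp
        have D': "w *\<^sub>R C = (w / t) *\<^sub>R D - (w * (1 - t) / t) *\<^sub>R B"
        proof -
          have "(w / t) *\<^sub>R D = (w * (1 - t) / t) *\<^sub>R B + (w / t * t) *\<^sub>R C"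
            unfolding D by (simp add: scaleR_add_right)
          then show ?thesis using False by simp
        qed
        have "p = u *\<^sub>R A + (v - w * (1 - t) / t) *\<^sub>R B + (w / t) *\<^sub>R D"
          unfolding p D' by (simp add: algebra_simps)
        moreover have "u + (v - w * (1 - t) / t) + w / t = 1"
        proof -
          have "w / t - w * (1 - t) / t = w" using False by (simp add: field_simps)
          with uvw(4) show ?thesis by simp
        qed
        ultimately show ?thesis unfolding triangle_def convex_hull_3
          using nn t uvw by (intro UnI1 CollectI exI[of _ u] exI[of _ "v - w * (1 - t) / t"] exI[of _ "w / t"]) auto
      qed
    next
      case False
      then have t1: "t < 1" using t uvw by (cases "t = 1") auto
      have "w - v * t / (1 - t) = ((1 - t) * w - t * v) / (1 - t)" using t1 by (simp add: field_simps)
      with False t1 have nn: "w - v * t / (1 - t) \<ge> 0" by simp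
      have D': "v *\<^sub>R B = (v / (1 - t)) *\<^sub>R D - (v * t / (1 - t)) *\<^sub>R C"
      proof -
        have "(v / (1 - t)) *\<^sub>R D = (v / (1 - t) * (1 - t)) *\<^sub>R B + (v * t / (1 - t)) *\<^sub>R C"
          unfolding D by (simp add: scaleR_add_right)
        then show ?thesis using t1 by simp
      qed
      have "p = u *\<^sub>R A + (v / (1 - t)) *\<^sub>R D + (w - v * t / (1 - t)) *\<^sub>R C"
        unfolding p D' by (simp add: algebra_simps)
      moreover have "u + v / (1 - t) + (w - v * t / (1 - t)) = 1"
      proof -
        have "v - v * t = v * (1 - t)" by (simp add: algebra_simps)
        then have "(v - v * t) / (1 - t) = v" using t1 by simp
        then have "v / (1 - t) - v * t / (1 - t) = v" by (simp only: diff_divide_distrib)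
        with uvw(4) show ?thesis by simp
      qed
      ultimately show ?thesis unfolding triangle_def convex_hull_3
        using nn t t1 uvw by (intro UnI2 CollectI exI[of _ u] exI[of _ "v / (1 - t)"] exI[of _ "w - v * t / (1 - t)"]) auto
    qed
  qed
  moreover have "D \<in> triangle A B C"
    using assms hull_mono[of "{B, C}" "{A, B, C}"] unfolding triangle_def segment_convex_hull by blast
  then have "triangle A B D \<union> triangle A D C \<subseteq> triangle A B C"
    unfolding triangle_def by (intro Un_least hull_minimal) (auto intro: hull_inc)
  ultimately show ?thesis by blast
qed

text \<open>Some orthogonal map takes \<open>v\<close> to \<open>v'\<close>. A reflection exchanging
  the image of \<open>w\<close> with \<open>w'\<close> then corrects the second vector; it fixes
  \<open>v'\<close> because the inner products agree.\<close>

lemma orthogonal_transformation_pair: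
  fixes v w v' w' :: "real^'n"
  assumes "norm v = norm v'" "norm w = norm w'" "v \<bullet> w = v' \<bullet> w'"
  obtains f where "orthogonal_transformation f" "f v = v'" "f w = w'"
proof -
  obtain g where g: "orthogonal_transformation g" and gv: "g v = v'"
    using orthogonal_transformation_exists[OF assms(1)] by blast
  define e where "e = g w - w'"
  \<comment> \<open>Reflection along \<open>e\<close>. If \<open>e = 0\<close>, the subtracted
    vector is zero and \<open>r\<close> is the identity, as desired.\<close>
  define r where "r x = x - (2 * (x \<bullet> e) / (e \<bullet> e)) *\<^sub>R e" for x
  have "linear r"
    unfolding r_def by unfold_locales (auto simp: algebra_simps add_divide_distrib)
  moreover have "r x \<bullet> r y = x \<bullet> y" for x y
    by (cases "e = 0") (simp_all add: r_def inner_diff_left inner_diff_right inner_commute field_simps)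
  ultimately have r: "orthogonal_transformation r"
    by (simp add: orthogonal_transformation_def)
  have gw: "g w \<bullet> g w = w' \<bullet> w'" and vw: "v' \<bullet> g w = v' \<bullet> w'"
    using g assms gv by (metis orthogonal_transformation_def norm_eq)+
  have "v' \<bullet> e = 0" using vw by (simp add: e_def inner_diff_right)
  then have rv: "r v' = v'" by (simp add: r_def)
  have "2 * (g w \<bullet> e) = e \<bullet> e"
    using gw by (simp add: e_def inner_diff_left inner_diff_right inner_commute)
  then have rw: "r (g w) = w'"
    by (cases "e = 0") (simp_all add: r_def, simp_all add: e_def)
  show thesis
    using that[of "r \<circ> g"] orthogonal_transformation_compose[OF r g] rv rw gv by simp
qed

text \<open>By polarization the side lengths determine the inner product of the edge vectors at
  \<open>P\<close>, so an orthogonal map and a translation carry one triangle onto the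
  other.\<close>

lemma congruent_sets_SSS:
  assumes "dist P Q = dist p q" "dist P R = dist p r" "dist Q R = dist q r"
  shows "congruent_sets (triangle P Q R) (triangle p q r)"
proof -
  have n: "norm (Q - P) = norm (q - p)" "norm (R - P) = norm (r - p)"
    using assms by (simp_all add: dist_norm norm_minus_commute)
  have "norm ((Q - P) - (R - P)) = norm ((q - p) - (r - p))"
    using assms by (simp add: dist_norm)
  then have "(Q - P) \<bullet> (R - P) = (q - p) \<bullet> (r - p)"
    using n unfolding dot_norm_neg by simp
  from orthogonal_transformation_pair[OF n this]
  obtain f where f: "orthogonal_transformation f" "f (Q - P) = q - p" "f (R - P) = r - p"
    by blast
  then have lin: "linear f" by (simp add: orthogonal_transformation_def)
  define h where "h x = (p - f P) + f x" for x
  have h: "h P = p" "h Q = q" "h R = r"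
    using f lin by (simp_all add: h_def linear_diff algebra_simps)
  have "dist (h x) (h y) = dist x y" for x y
    using f(1) by (auto simp: h_def dist_norm orthogonal_transformation_isometry)
  moreover have "h ` triangle P Q R = triangle p q r"
  proof -
    have "h ` S = (+) (p - f P) ` (f ` S)" for S
      by (auto simp: h_def)
    then show ?thesis
      using h unfolding triangle_def
      by (simp add: convex_hull_linear_image[OF lin] flip: convex_hull_translation)
        (simp add: h_def)
  qed
  ultimately show ?thesis unfolding congruent_sets_def by blast
qed

lemma lmeasurable_triangle: "triangle A B C \<in> lmeasurable"
  unfolding triangle_def by (intro lmeasurable_compact finite_imp_compact_convex_hull) auto

text \<open>Heron's formula in squared form, which makes areas polynomial in the squared sides;
  degenerate triangles are included.\<close>

lemma measure_triangle:
  "16 * (measure lebesgue (triangle A B C))\<^sup>2 =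
    4 * (dist A B)\<^sup>2 * (dist A C)\<^sup>2 - ((dist A B)\<^sup>2 + (dist A C)\<^sup>2 - (dist B C)\<^sup>2)\<^sup>2"
proof -
  define x y z where xyz: "x = dist B C" "y = dist A C" "z = dist A B"
  define s where "s = (x + y + z) / 2"
  have "compact (triangle A B C)"
    unfolding triangle_def by (intro finite_imp_compact_convex_hull) auto
  then have "measure lebesgue (triangle A B C) = sqrt (s * (s - x) * (s - y) * (s - z))"
    using heron[of A B C] by (simp add: borel_compact xyz s_def triangle_def)
  moreover have "s * (s - x) * (s - y) * (s - z) \<ge> 0"
    using dist_triangle[of A B C] dist_triangle[of A C B] dist_triangle[of B C A]
    by (intro mult_nonneg_nonneg) (auto simp: s_def xyz dist_commute)
  ultimately have "16 * (measure lebesgue (triangle A B C))\<^sup>2 = 16 * (s * (s - x) * (s - y) * (s - z))"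
    by simp
  also have "\<dots> = 4 * z\<^sup>2 * y\<^sup>2 - (z\<^sup>2 + y\<^sup>2 - x\<^sup>2)\<^sup>2"
    by (simp add: s_def field_simps power2_eq_square)
  finally show ?thesis by (simp add: xyz)
qed

section \<open>Covers by copies of the tile\<close>

definition copies :: "real^2 \<Rightarrow> real^2 \<Rightarrow> real^2 \<Rightarrow> (real^2) set set" where
  "copies P Q R = {triangle p q r | p q r.
     dist p q = dist P Q \<and> dist p r = dist P R \<and> dist q r = dist Q R}"

text \<open>An upper bound on the count and silence about overlaps make the notion stable under
  unions, where equal copies may merge. \<open>tiling_if_coverable\<close> recovers both from the
  area.\<close>

definition coverable :: "real^2 \<Rightarrow> real^2 \<Rightarrow> real^2 \<Rightarrow> nat \<Rightarrow> (real^2) set \<Rightarrow> bool" where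
  "coverable P Q R n X \<longleftrightarrow>
     (\<exists>\<T>. finite \<T> \<and> card \<T> \<le> n \<and> \<T> \<subseteq> copies P Q R \<and> \<Union>\<T> = X)"

lemma copiesD:
  assumes "S \<in> copies P Q R"
  shows "congruent_sets (triangle P Q R) S" "S \<in> lmeasurable" "convex S" "closed S"
    "measure lebesgue S = measure lebesgue (triangle P Q R)"
proof -
  obtain p q r where S: "S = triangle p q r"
    and d: "dist p q = dist P Q" "dist p r = dist P R" "dist q r = dist Q R"
    using assms unfolding copies_def by blast
  show "congruent_sets (triangle P Q R) S" unfolding S using d by (intro congruent_sets_SSS) auto
  show "S \<in> lmeasurable" unfolding S by (rule lmeasurable_triangle)
  show "convex S" unfolding S triangle_def by simp
  show "closed S" unfolding S triangle_def
    by (intro compact_imp_closed finite_imp_compact_convex_hull) auto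
  have "(measure lebesgue S)\<^sup>2 = (measure lebesgue (triangle P Q R))\<^sup>2"
    using measure_triangle[of p q r] measure_triangle[of P Q R] unfolding S d by linarith
  then show "measure lebesgue S = measure lebesgue (triangle P Q R)"
    by (rule power2_eq_imp_eq) simp_all
qed

text \<open>A common point interior to \<open>S\<close> would be a limit of interior points of
  \<open>T\<close>, since a convex set with nonempty interior lies in the closure of that interior;
  so the two interiors would meet.\<close>

lemma convex_overlap_frontier:
  fixes S T :: "'a::euclidean_space set"
  assumes "convex S" "convex T" "closed S" "closed T" "interior S \<noteq> {}" "interior T \<noteq> {}"
    and "interior (S \<inter> T) = {}"
  shows "S \<inter> T \<subseteq> frontier S \<inter> frontier T"
proof -
  have *: "S \<inter> T \<subseteq> frontier S"
    if "convex T" "closed S" "closed T" "interior T \<noteq> {}" "interior (S \<inter> T) = {}" for S T :: "'a set"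
  proof
    fix x assume x: "x \<in> S \<inter> T"
    have "x \<notin> interior S"
    proof
      assume "x \<in> interior S"
      moreover have "x \<in> closure (interior T)"
        using x that convex_closure_interior[of T] by auto
      ultimately have "interior S \<inter> interior T \<noteq> {}"
        using open_Int_closure_eq_empty[OF open_interior] by blast
      then show False using that by simp
    qed
    then show "x \<in> frontier S" using x that by (simp add: frontier_def)
  qed
  from *[of T S] *[of S T] show ?thesis using assms by (auto simp: Int_commute)
qed

text \<open>The area of \<open>X\<close> equals that of \<open>N\<close> tiles, so no tile can be
  missing and no two can share positive area. For convex tiles a null overlap lies in both
  frontiers.\<close>

lemma tiling_if_coverable:
  assumes cov: "coverable P Q R N X"
    and pos: "measure lebesgue (triangle P Q R) > 0"
    and area: "measure lebesgue X = real N * measure lebesgue (triangle P Q R)"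
  shows "\<exists>\<T>. tiling N X (triangle P Q R) \<T>"
proof -
  define m where "m = measure lebesgue (triangle P Q R)"
  obtain \<T> where fin: "finite \<T>" and card: "card \<T> \<le> N" and sub: "\<T> \<subseteq> copies P Q R"
    and X: "\<Union>\<T> = X"
    using cov unfolding coverable_def by blast
  have lm: "S \<in> lmeasurable" and ms: "measure lebesgue S = m" if "S \<in> \<T>" for S
    using copiesD(2,5)[of S P Q R] sub that unfolding m_def by (simp_all add: subset_iff)
  have le: "measure lebesgue (\<Union>\<U>) \<le> real (card \<U>) * m" if "\<U> \<subseteq> \<T>" for \<U>
  proof -
    have "measure lebesgue (\<Union>\<U>) \<le> (\<Sum>S\<in>\<U>. measure lebesgue S)"
      using that fin lm by (intro measure_Union_le) (auto intro: finite_subset)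
    also have "\<dots> = real (card \<U>) * m" using ms that by (simp add: subset_iff)
    finally show ?thesis .
  qed
  have "real N * m \<le> real (card \<T>) * m" using le[of \<T>] X area m_def by simp
  then have cardN: "card \<T> = N" using pos card m_def by simp
  have null: "measure lebesgue (S \<inter> S') = 0" if S: "S \<in> \<T>" "S' \<in> \<T>" "S \<noteq> S'" for S S'
  proof -
    \<comment> \<open>The other \<open>N - 2\<close> tiles have area at most
      \<open>(N - 2) * m\<close>, so \<open>S\<close> and \<open>S'\<close> must together contribute
      the full \<open>2 * m\<close>.\<close>
    let ?V = "\<T> - {S, S'}"
    have "card ?V + 2 = N"
      using S fin cardN card_mono[of \<T> "{S, S'}"] by (simp add: card_Diff_subset)
    then have cV: "real (card ?V) = real N - 2" by linarith
    have mV: "\<Union>?V \<in> lmeasurable" using fin lm by (intro fmeasurable.finite_Union) auto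
    have "X = (S \<union> S') \<union> \<Union>?V" using X S by blast
    moreover have "S \<union> S' \<in> sets lebesgue" using lm S by blast
    moreover have "\<Union>?V \<in> sets lebesgue" using mV by (rule fmeasurableD)
    ultimately have "measure lebesgue X \<le> measure lebesgue (S \<union> S') + measure lebesgue (\<Union>?V)"
      by (simp only: measure_Un_le)
    also have "\<dots> \<le> (m + m - measure lebesgue (S \<inter> S')) + (real N - 2) * m"
      using le[of ?V] cV lm ms S by (simp add: measure_Un3)
    finally have "measure lebesgue (S \<inter> S') \<le> 0" using area m_def by (simp add: algebra_simps)
    then show ?thesis by (simp add: measure_le_0_iff)
  qed
  have "S \<inter> S' \<subseteq> frontier S \<inter> frontier S'" if S: "S \<in> \<T>" "S' \<in> \<T>" "S \<noteq> S'" for S S'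
  proof -
    have "S \<in> copies P Q R" "S' \<in> copies P Q R" using sub S by auto
    then have cvx: "convex S" "convex S'" "closed S" "closed S'" by (simp_all add: copiesD(3,4))
    have "negligible (S \<inter> S')"
      using null[OF S] lm S by (simp add: negligible_iff_measure0 fmeasurable.Int)
    then have "interior (S \<inter> S') = {}"
      using cvx by (simp only: convex_Int negligible_convex_interior)
    \<comment> \<open>A convex set with empty interior would be null, but every tile has area
      \<open>m > 0\<close>.\<close>
    moreover have "interior U \<noteq> {}" if "U \<in> \<T>" "convex U" for U
    proof -
      have "\<not> negligible U"
        using pos negligible_iff_measure0[OF lm[OF that(1)]] ms[OF that(1)] m_def by linarith
      then show ?thesis using negligible_convex_interior[OF that(2)] by simp
    qed
    ultimately show ?thesis using cvx S by (intro convex_overlap_frontier) auto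
  qed
  then show ?thesis
    unfolding tiling_def using fin cardN sub copiesD(1) X by (intro exI[of _ \<T>]) auto
qed

lemma coverable_Un:
  assumes "coverable P Q R m X" "coverable P Q R n Y"
  shows "coverable P Q R (m + n) (X \<union> Y)"
proof -
  obtain \<S> \<T> where "finite \<S>" "card \<S> \<le> m" "\<S> \<subseteq> copies P Q R" "\<Union>\<S> = X"
    "finite \<T>" "card \<T> \<le> n" "\<T> \<subseteq> copies P Q R" "\<Union>\<T> = Y"
    using assms unfolding coverable_def by blast
  then show ?thesis
    using card_Un_le[of \<S> \<T>] unfolding coverable_def by (intro exI[of _ "\<S> \<union> \<T>"]) auto
qed

lemma coverable_UN:
  assumes "finite I" "\<And>i. i \<in> I \<Longrightarrow> coverable P Q R k (X i)"
  shows "coverable P Q R (card I * k) (\<Union>i\<in>I. X i)"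
  using assms
proof (induction I rule: finite_induct)
  case empty
  then show ?case by (auto simp: coverable_def)
next
  case (insert i I)
  then have "coverable P Q R (k + card I * k) (X i \<union> (\<Union>i\<in>I. X i))"
    by (intro coverable_Un) auto
  then show ?case using insert by simp
qed

lemma coverable_copy:
  assumes "dist p q = dist P Q" "dist p r = dist P R" "dist q r = dist Q R"
  shows "coverable P Q R 1 (triangle p q r)"
  unfolding coverable_def copies_def using assms
  by (intro exI[of _ "{triangle p q r}"]) auto

section \<open>Lattice covers of triangles and parallelograms\<close>

text \<open>Affine coordinates with origin \<open>A\<close>, turning questions about covers into
  statements about coordinate regions.\<close>

definition lattice_map :: "'a \<Rightarrow> 'a \<Rightarrow> 'a \<Rightarrow> real \<times> real \<Rightarrow> 'a::real_vector" where
  "lattice_map A v w = (\<lambda>(x, y). A + x *\<^sub>R v + y *\<^sub>R w)"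

lemma lattice_map_up:
  "triangle (A + i *\<^sub>R v + j *\<^sub>R w) (A + (i + 1) *\<^sub>R v + j *\<^sub>R w) (A + i *\<^sub>R v + (j + 1) *\<^sub>R w) =
   lattice_map A v w ` {(x, y). i \<le> x \<and> j \<le> y \<and> x + y \<le> i + j + 1}"
proof -
  have "triangle (A + i *\<^sub>R v + j *\<^sub>R w) (A + (i + 1) *\<^sub>R v + j *\<^sub>R w) (A + i *\<^sub>R v + (j + 1) *\<^sub>R w) =
    {A + (i + s) *\<^sub>R v + (j + t) *\<^sub>R w | s t. 0 \<le> s \<and> 0 \<le> t \<and> s + t \<le> 1}"
    unfolding triangle_def convex_hull_3_alt by (simp add: algebra_simps)
  also have "\<dots> = lattice_map A v w ` {(x, y). i \<le> x \<and> j \<le> y \<and> x + y \<le> i + j + 1}"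
    (is "?L = ?f ` ?S")
  proof
    show "?L \<subseteq> ?f ` ?S"
    proof
      fix z assume "z \<in> ?L"
      then obtain s t where "z = A + (i + s) *\<^sub>R v + (j + t) *\<^sub>R w" "0 \<le> s" "0 \<le> t" "s + t \<le> 1" by blast
      then show "z \<in> ?f ` ?S"
        by (intro image_eqI[of _ _ "(i + s, j + t)"]) (auto simp: lattice_map_def)
    qed
    show "?f ` ?S \<subseteq> ?L"
    proof
      fix z assume "z \<in> ?f ` ?S"
      then obtain x y where "z = A + x *\<^sub>R v + y *\<^sub>R w" "i \<le> x" "j \<le> y" "x + y \<le> i + j + 1"
        by (auto simp: lattice_map_def)
      then show "z \<in> ?L" by (intro CollectI exI[of _ "x - i"] exI[of _ "y - j"]) auto
    qed
  qed
  finally show ?thesis .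
qed

lemma lattice_map_down:
  "triangle (A + (i + 1) *\<^sub>R v + (j + 1) *\<^sub>R w) (A + i *\<^sub>R v + (j + 1) *\<^sub>R w) (A + (i + 1) *\<^sub>R v + j *\<^sub>R w) =
   lattice_map A v w ` {(x, y). x \<le> i + 1 \<and> y \<le> j + 1 \<and> i + j + 1 \<le> x + y}"
proof -
  \<comment> \<open>A half turn exchanges the two kinds of half cell: this is an upward one for
    \<open>- v\<close> and \<open>- w\<close>.\<close>
  have "triangle (A + (i + 1) *\<^sub>R v + (j + 1) *\<^sub>R w) (A + i *\<^sub>R v + (j + 1) *\<^sub>R w) (A + (i + 1) *\<^sub>R v + j *\<^sub>R w)
    = lattice_map A (- v) (- w) ` {(x, y). - (i + 1) \<le> x \<and> - (j + 1) \<le> y \<and> x + y \<le> - (i + 1) + - (j + 1) + 1}"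
    by (subst lattice_map_up[symmetric]) (simp add: algebra_simps)
  also have "\<dots> = lattice_map A v w ` (\<lambda>(x, y). (- x, - y)) `
      {(x, y). - (i + 1) \<le> x \<and> - (j + 1) \<le> y \<and> x + y \<le> - (i + 1) + - (j + 1) + 1}"
    by (simp add: image_image lattice_map_def case_prod_unfold)
  also have "(\<lambda>(x, y). (- x, - y)) `
      {(x, y). - (i + 1) \<le> x \<and> - (j + 1) \<le> y \<and> x + y \<le> - (i + 1) + - (j + 1) + 1} =
      {(x, y). x \<le> i + 1 \<and> y \<le> j + 1 \<and> i + j + 1 \<le> x + y}" (is "?n ` ?S = ?B")
  proof
    show "?n ` ?S \<subseteq> ?B" by auto
    show "?B \<subseteq> ?n ` ?S"
    proof
      fix z assume "z \<in> ?B"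
      then show "z \<in> ?n ` ?S" by (intro image_eqI[of _ _ "?n z"]) auto
    qed
  qed
  finally show ?thesis .
qed

lemma unit_interval_index:
  fixes x :: real
  assumes "0 \<le> x" "x \<le> real n" "n > 0"
  obtains i where "i < n" "real i \<le> x" "x \<le> real i + 1"
proof (cases "x = real n")
  case True
  \<comment> \<open>The floor of \<open>n\<close> would be out of range, so the right endpoint goes
    to the last interval.\<close>
  then show ?thesis using that[of "n - 1"] assms by (simp add: of_nat_diff)
next
  case False
  have "real (nat \<lfloor>x\<rfloor>) \<le> x" "x \<le> real (nat \<lfloor>x\<rfloor>) + 1"
    using assms by linarith+
  moreover from this(1) False assms have "nat \<lfloor>x\<rfloor> < n" by linarith
  ultimately show ?thesis using that by blast
qed

context
  fixes P Q R A v w :: "real^2"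
  assumes v: "norm v = dist P Q" and w: "norm w = dist P R" and vw: "norm (v - w) = dist Q R"
begin

lemma coverable_up:
  "coverable P Q R 1 (lattice_map A v w ` {(x, y). i \<le> x \<and> j \<le> y \<and> x + y \<le> i + j + 1})"
  unfolding lattice_map_up[symmetric] using v w vw
  by (intro coverable_copy) (simp_all add: dist_norm algebra_simps norm_minus_commute)

lemma coverable_down:
  "coverable P Q R 1 (lattice_map A v w ` {(x, y). x \<le> i + 1 \<and> y \<le> j + 1 \<and> i + j + 1 \<le> x + y})"
  unfolding lattice_map_down[symmetric] using v w vw
  by (intro coverable_copy) (simp_all add: dist_norm algebra_simps norm_minus_commute)

text \<open>A diagonal cuts each of the \<open>p * q\<close> unit cells into an upward and a
  downward copy of the tile.\<close>

lemma coverable_parallelogram: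
  assumes "p > 0" "q > 0"
  shows "coverable P Q R (2 * p * q)
     (lattice_map A v w ` {(x, y). 0 \<le> x \<and> x \<le> real p \<and> 0 \<le> y \<and> y \<le> real q})"
proof -
  define U where "U i j = {(x::real, y::real). i \<le> x \<and> j \<le> y \<and> x + y \<le> i + j + 1}" for i j
  define D where "D i j = {(x::real, y::real). x \<le> i + 1 \<and> y \<le> j + 1 \<and> i + j + 1 \<le> x + y}" for i j
  let ?f = "lattice_map A v w"
  let ?C = "\<Union>(i, j)\<in>{..<p} \<times> {..<q}. U (real i) (real j) \<union> D (real i) (real j)"
  have "coverable P Q R (card ({..<p} \<times> {..<q}) * (1 + 1))
    (\<Union>z\<in>{..<p} \<times> {..<q}. ?f ` U (real (fst z)) (real (snd z)) \<union> ?f ` D (real (fst z)) (real (snd z)))"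
    unfolding U_def D_def
    by (intro coverable_UN coverable_Un coverable_up coverable_down) auto
  moreover have "(\<Union>z\<in>{..<p} \<times> {..<q}. ?f ` U (real (fst z)) (real (snd z)) \<union> ?f ` D (real (fst z)) (real (snd z)))
    = ?f ` ?C" by (simp add: image_UN image_Un case_prod_unfold)
  moreover have "?C = {(x, y). 0 \<le> x \<and> x \<le> real p \<and> 0 \<le> y \<and> y \<le> real q}"
  proof
    show "?C \<subseteq> {(x, y). 0 \<le> x \<and> x \<le> real p \<and> 0 \<le> y \<and> y \<le> real q}"
      by (auto simp: U_def D_def)
    show "{(x, y). 0 \<le> x \<and> x \<le> real p \<and> 0 \<le> y \<and> y \<le> real q} \<subseteq> ?C"
    proof clarify
      fix x y :: real
      assume xy: "0 \<le> x" "x \<le> real p" "0 \<le> y" "y \<le> real q"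
      obtain i where i: "i < p" "real i \<le> x" "x \<le> real i + 1"
        using unit_interval_index[of x p] xy assms by auto
      obtain j where j: "j < q" "real j \<le> y" "y \<le> real j + 1"
        using unit_interval_index[of y q] xy assms by auto
      have "(x, y) \<in> U (real i) (real j) \<union> D (real i) (real j)"
        using i j by (auto simp: U_def D_def)
      then show "(x, y) \<in> ?C" using i j by blast
    qed
  qed
  moreover have "card ({..<p} \<times> {..<q}) * (1 + 1) = 2 * p * q" by simp
  ultimately show ?thesis by (simp only:)
qed

text \<open>Enlarging the side from \<open>n + 1\<close> to \<open>n + 2\<close> adds a strip of
  \<open>n + 2\<close> upward and \<open>n + 1\<close> downward copies, and \<open>2 * n + 3\<close>
  is the difference of the squares.\<close>

lemma coverable_triangle_lattice:
  "coverable P Q R ((Suc n)\<^sup>2) (lattice_map A v w ` {(x, y). 0 \<le> x \<and> 0 \<le> y \<and> x + y \<le> real (Suc n)})"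
proof (induction n)
  case 0
  then show ?case using coverable_up[of 0 0] by simp
next
  case (Suc n)
  define T where "T m = {(x::real, y::real). 0 \<le> x \<and> 0 \<le> y \<and> x + y \<le> real m}" for m
  define U where "U i = {(x::real, y::real). real i \<le> x \<and> real (Suc n - i) \<le> y \<and>
    x + y \<le> real i + real (Suc n - i) + 1}" for i
  define D where "D i = {(x::real, y::real). x \<le> real i + 1 \<and> y \<le> real (n - i) + 1 \<and>
    real i + real (n - i) + 1 \<le> x + y}" for i
  let ?f = "lattice_map A v w"
  have eq: "T (Suc (Suc n)) = T (Suc n) \<union> ((\<Union>i\<le>Suc n. U i) \<union> (\<Union>i\<le>n. D i))"
  proof
    show "T (Suc n) \<union> ((\<Union>i\<le>Suc n. U i) \<union> (\<Union>i\<le>n. D i)) \<subseteq> T (Suc (Suc n))"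
      by (auto simp: T_def U_def D_def of_nat_diff)
    show "T (Suc (Suc n)) \<subseteq> T (Suc n) \<union> ((\<Union>i\<le>Suc n. U i) \<union> (\<Union>i\<le>n. D i))"
    proof
      fix z assume z: "z \<in> T (Suc (Suc n))"
      obtain x y where xy: "z = (x, y)" by (cases z)
      with z have *: "0 \<le> x" "0 \<le> y" "x + y \<le> real n + 2" by (auto simp: T_def)
      obtain i where i: "i < Suc (Suc n)" "real i \<le> x" "x \<le> real i + 1"
        using unit_interval_index[of x "Suc (Suc n)"] * by auto
      show "z \<in> T (Suc n) \<union> ((\<Union>i\<le>Suc n. U i) \<union> (\<Union>i\<le>n. D i))"
      proof (cases "real (Suc n - i) \<le> y")
        case True
        then have "z \<in> U i" using i(1,2) * xy by (simp add: U_def)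
        moreover have "i \<in> {..Suc n}" using i(1) by simp
        ultimately show ?thesis by blast
      next
        case False
        \<comment> \<open>In the last column the failed inequality would read
          \<open>0 \<le> y\<close>; that column has no downward copy.\<close>
        then have "i \<noteq> Suc n" using *(2) by auto
        then have "i \<in> {..n}" using i(1) by simp
        moreover have "z \<in> T (Suc n) \<union> D i"
        proof (cases "x + y \<le> real (Suc n)")
          case True
          then show ?thesis using * xy by (simp add: T_def)
        next
          case greater: False
          have "real i + real (n - i) = real n" "real (Suc n - i) = real (n - i) + 1"
            using \<open>i \<in> {..n}\<close> by (simp_all add: of_nat_diff)
          then have "z \<in> D i" using False greater i(3) xy by (simp add: D_def)
          then show ?thesis by blast
        qed
        ultimately show ?thesis by blast
      qed
    qed
  qed
  have "coverable P Q R ((Suc n)\<^sup>2) (?f ` T (Suc n))"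
    using Suc.IH by (simp only: T_def)
  moreover have "coverable P Q R (card {..Suc n} * 1) (\<Union>i\<le>Suc n. ?f ` U i)"
    unfolding U_def by (rule coverable_UN[OF finite_atMost coverable_up])
  moreover have "coverable P Q R (card {..n} * 1) (\<Union>i\<le>n. ?f ` D i)"
    unfolding D_def by (rule coverable_UN[OF finite_atMost coverable_down])
  ultimately have "coverable P Q R ((Suc n)\<^sup>2 + (card {..Suc n} * 1 + card {..n} * 1))
    (?f ` T (Suc n) \<union> ((\<Union>i\<le>Suc n. ?f ` U i) \<union> (\<Union>i\<le>n. ?f ` D i)))"
    by (intro coverable_Un)
  also have "?f ` T (Suc n) \<union> ((\<Union>i\<le>Suc n. ?f ` U i) \<union> (\<Union>i\<le>n. ?f ` D i)) = ?f ` T (Suc (Suc n))"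
    unfolding eq by blast
  also have "(Suc n)\<^sup>2 + (card {..Suc n} * 1 + card {..n} * 1) = (Suc (Suc n))\<^sup>2"
    by (simp add: power2_eq_square)
  finally show ?case unfolding T_def .
qed

end

lemma coverable_scaled_triangle:
  assumes "n > 0" and "dist X Y = real n * dist P Q" "dist X Z = real n * dist P R"
    "dist Y Z = real n * dist Q R"
  shows "coverable P Q R (n\<^sup>2) (triangle X Y Z)"
proof -
  obtain k where k: "n = Suc k" using assms(1) gr0_implies_Suc by blast
  define v w where "v = (1 / real n) *\<^sub>R (Y - X)" and "w = (1 / real n) *\<^sub>R (Z - X)"
  have "norm v = dist P Q" "norm w = dist P R"
    using assms by (simp_all add: v_def w_def dist_norm norm_minus_commute)
  moreover have "v - w = (1 / real n) *\<^sub>R (Y - Z)" by (simp add: v_def w_def algebra_simps)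
  then have "norm (v - w) = dist Q R" using assms by (simp add: dist_norm)
  ultimately have "coverable P Q R (n\<^sup>2)
    (lattice_map X v w ` {(x, y). 0 \<le> x \<and> 0 \<le> y \<and> x + y \<le> real n})"
    unfolding k by (rule coverable_triangle_lattice)
  also have "lattice_map X v w ` {(x, y). 0 \<le> x \<and> 0 \<le> y \<and> x + y \<le> real n} = triangle X Y Z"
    (is "?f ` ?S = _")
  proof
    show "?f ` ?S \<subseteq> triangle X Y Z"
    proof clarify
      fix x y :: real assume xy: "0 \<le> x" "0 \<le> y" "x + y \<le> real n"
      have "x / real n + y / real n \<le> 1" using xy assms(1) by (simp add: field_simps)
      then show "?f (x, y) \<in> triangle X Y Z"
        unfolding triangle_def convex_hull_3_alt lattice_map_def v_def w_def using xy
        by (intro CollectI exI[of _ "x / real n"] exI[of _ "y / real n"]) simp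
    qed
    show "triangle X Y Z \<subseteq> ?f ` ?S"
    proof
      fix z assume "z \<in> triangle X Y Z"
      then obtain s t where st: "z = X + s *\<^sub>R (Y - X) + t *\<^sub>R (Z - X)" "0 \<le> s" "0 \<le> t" "s + t \<le> 1"
        unfolding triangle_def convex_hull_3_alt by blast
      have "real n * s + real n * t \<le> real n"
        using st(4) mult_left_mono[of "s + t" 1 "real n"] by (simp add: distrib_left)
      then show "z \<in> ?f ` ?S" using st assms(1)
        by (intro image_eqI[of _ _ "(real n * s, real n * t)"]) (simp_all add: lattice_map_def v_def w_def)
    qed
  qed
  finally show ?thesis .
qed

text \<open>The parallelogram is given as two triangles on its diagonal \<open>XW\<close>, to fit a
  dissection assembled from triangles.\<close>

lemma coverable_scaled_parallelogram:
  fixes X v w :: "real^2"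
  assumes "p > 0" "q > 0" "norm v = dist P Q" "norm w = dist P R" "norm (v - w) = dist Q R"
    and Y: "Y = X + real p *\<^sub>R v" and Z: "Z = X + real q *\<^sub>R w" and W: "W = Y + Z - X"
  shows "coverable P Q R (2 * p * q) (triangle X Y W \<union> triangle X W Z)"
proof -
  have "coverable P Q R (2 * p * q)
     (lattice_map X v w ` {(x, y). 0 \<le> x \<and> x \<le> real p \<and> 0 \<le> y \<and> y \<le> real q})"
    using assms by (intro coverable_parallelogram)
  also have "lattice_map X v w ` {(x, y). 0 \<le> x \<and> x \<le> real p \<and> 0 \<le> y \<and> y \<le> real q} =
      triangle X Y W \<union> triangle X W Z" (is "?f ` ?S = _")
  proof
    show "?f ` ?S \<subseteq> triangle X Y W \<union> triangle X W Z"
    proof clarify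
      fix x y :: real assume xy: "0 \<le> x" "x \<le> real p" "0 \<le> y" "y \<le> real q"
        and no: "?f (x, y) \<notin> triangle X W Z"
      \<comment> \<open>The same point in the affine coordinates of each half; comparing
        \<open>x / p\<close> with \<open>y / q\<close> tells the side of the diagonal.\<close>
      have eq: "?f (x, y) = X + (x / p - y / q) *\<^sub>R (Y - X) + (y / q) *\<^sub>R (W - X)"
        "?f (x, y) = X + (x / p) *\<^sub>R (W - X) + (y / q - x / p) *\<^sub>R (Z - X)"
        using assms(1,2) unfolding W Y Z lattice_map_def
        by (simp_all add: scaleR_add_right scaleR_diff_left left_diff_distrib)
      have le: "x / p \<le> 1" "y / q \<le> 1" "0 \<le> x / p" "0 \<le> y / q" using xy assms(1,2) by simp_all
      have "y / q \<le> x / p"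
      proof (rule ccontr)
        assume "\<not> y / q \<le> x / p"
        then have "?f (x, y) \<in> triangle X W Z"
          unfolding triangle_def convex_hull_3_alt using eq(2) le
          by (intro CollectI exI[of _ "x / p"] exI[of _ "y / q - x / p"]) simp
        with no show False by blast
      qed
      then show "?f (x, y) \<in> triangle X Y W"
        unfolding triangle_def convex_hull_3_alt using eq(1) le
        by (intro CollectI exI[of _ "x / p - y / q"] exI[of _ "y / q"]) simp
    qed
    have "triangle X Y W \<subseteq> ?f ` ?S"
    proof
      fix z assume "z \<in> triangle X Y W"
      then obtain s t where "z = X + s *\<^sub>R (Y - X) + t *\<^sub>R (W - X)" "0 \<le> s" "0 \<le> t" "s + t \<le> 1"
        unfolding triangle_def convex_hull_3_alt by blast
      moreover from this have "(s + t) * real p \<le> real p" by (intro mult_left_le_one_le) auto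
      ultimately show "z \<in> ?f ` ?S"
        by (intro image_eqI[of _ _ "((s + t) * real p, t * real q)"])
          (auto simp: lattice_map_def W Y Z scaleR_add_right scaleR_add_left distrib_right
            mult_left_le_one_le)
    qed
    moreover have "triangle X W Z \<subseteq> ?f ` ?S"
    proof
      fix z assume "z \<in> triangle X W Z"
      then obtain s t where "z = X + s *\<^sub>R (W - X) + t *\<^sub>R (Z - X)" "0 \<le> s" "0 \<le> t" "s + t \<le> 1"
        unfolding triangle_def convex_hull_3_alt by blast
      moreover from this have "(s + t) * real q \<le> real q" by (intro mult_left_le_one_le) auto
      ultimately show "z \<in> ?f ` ?S"
        by (intro image_eqI[of _ _ "(s * real p, (s + t) * real q)"])
          (auto simp: lattice_map_def W Y Z scaleR_add_right scaleR_add_left distrib_right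
            mult_left_le_one_le)
    qed
    ultimately show "triangle X Y W \<union> triangle X W Z \<subseteq> ?f ` ?S" by blast
  qed
  finally show ?thesis .
qed

section \<open>Dissection of the isosceles triangle\<close>

text \<open>Stewart's theorem; it gives the lengths of the cevians \<open>AD\<close>,
  \<open>AE\<close> and \<open>DF\<close> without choosing coordinates for the plane.\<close>

lemma stewart:
  fixes X Y Z :: "'a::real_inner"
  shows "(dist X (Y + t *\<^sub>R (Z - Y)))\<^sup>2 =
    (1 - t) * (dist X Y)\<^sup>2 + t * (dist X Z)\<^sup>2 - t * (1 - t) * (dist Y Z)\<^sup>2"
proof -
  define y z where "y = Y - X" and "z = Z - X"
  have "X - (Y + t *\<^sub>R (Z - Y)) = - (y + t *\<^sub>R (z - y))" "X - Y = - y" "X - Z = - z" "Y - Z = y - z"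
    by (simp_all add: y_def z_def algebra_simps)
  then show ?thesis
    unfolding dist_norm power2_norm_eq_inner
    by (simp add: inner_simps inner_commute algebra_simps power2_eq_square)
qed

lemma closed_segment_line:
  fixes X e :: "'a::real_vector"
  assumes "r \<le> s" "s \<le> t"
  shows "X + s *\<^sub>R e \<in> closed_segment (X + r *\<^sub>R e) (X + t *\<^sub>R e)"
proof -
  have "(\<lambda>x. X + x *\<^sub>R e) s \<in> (\<lambda>x. X + x *\<^sub>R e) ` closed_segment r t"
    using assms by (intro imageI) (simp add: closed_segment_eq_real_ivl)
  also have "(\<lambda>x. X + x *\<^sub>R e) ` closed_segment r t = (+) X ` closed_segment (r *\<^sub>R e) (t *\<^sub>R e)"
    by (subst closed_segment_linear_image[of "\<lambda>x. x *\<^sub>R e"])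
      (auto simp: image_image linear_scaleR_left)
  also have "\<dots> = closed_segment (X + r *\<^sub>R e) (X + t *\<^sub>R e)"
    by (simp add: closed_segment_translation)
  finally show ?thesis .
qed

text \<open>The points \<open>D\<close>, \<open>E\<close>, \<open>G\<close> lie on \<open>BC\<close> with \<open>BD = EC = DG = acJ\<close>, so \<open>ABD\<close> and \<open>ACE\<close> are mirror
images similar to the tile. The remaining triangle \<open>ADE\<close> is not tiled separately: with \<open>F\<close> on \<open>AE\<close>
chosen to make \<open>ADF\<close> similar to the tile, the leftover \<open>DFE\<close> is completed to \<open>DGF\<close>, which is
again similar to the tile and has \<open>FG\<close> parallel to \<open>AC\<close>; \<open>H\<close> on \<open>AC\<close> is the fourth vertex of the
parallelogram on \<open>FA\<close> and \<open>FG\<close>.\<close>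

lemma coverable_isosceles:
  fixes a b c J :: nat and P Q R A B C :: "real^2"
  assumes pos: "a > 0" "b > 0" "c > 0" "J > 0" and rel: "a\<^sup>2 + b * c = c\<^sup>2"
    and tile: "dist P Q = real c" "dist P R = real b" "dist Q R = real a"
    and AB: "dist A B = real (c * c * J)" and AC: "dist A C = real (c * c * J)"
    and BC: "dist B C = real ((2 * c + b) * a * J)"
  shows "coverable P Q R ((c * J)\<^sup>2 + (b * J)\<^sup>2 + (a * J)\<^sup>2 + 2 * ((c - b) * J) * (b * J) + (b * J)\<^sup>2)
    (triangle A B C)"
proof -
  have "0 < a\<^sup>2" using pos by simp
  then have "b * c < c * c" using rel unfolding power2_eq_square by linarith
  then have bc: "b < c" by simp
  have rel': "(real a)\<^sup>2 = (real c)\<^sup>2 - real b * real c"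
    using arg_cong[OF rel, of real] by (simp only: of_nat_add of_nat_mult of_nat_power)
  \<comment> \<open>A step of length \<open>a * J\<close> along \<open>BC\<close>, so that
    \<open>D\<close>, \<open>E\<close>, \<open>G\<close> and \<open>C\<close> all have integer
    parameters.\<close>
  define e where "e = (1 / (2 * real c + real b)) *\<^sub>R (C - B)"
  define pt where "pt t = B + t *\<^sub>R e" for t
  have ptC: "C = pt (2 * c + b)" using pos by (simp add: pt_def e_def)
  define D E G where "D = pt c" and "E = pt (c + b)" and "G = pt (2 * c)"
  \<comment> \<open>This ratio gives \<open>AF = b * b * J\<close>, matching the side
    \<open>b\<close> of the tile at scale \<open>b * J\<close>.\<close>
  define F where "F = A + (b / c) *\<^sub>R (E - A)"
  \<comment> \<open>Chosen so that \<open>H - A\<close> equals \<open>G - F\<close>.\<close>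
  define H where "H = A + ((real c - real b) / c) *\<^sub>R (C - A)"
  have ne: "norm e = real a * real J"
    using BC pos by (simp add: e_def dist_norm norm_minus_commute)
  have dpt: "dist (pt s) (pt t) = \<bar>s - t\<bar> * (real a * real J)" for s t
    by (simp add: pt_def dist_norm ne flip: scaleR_diff_left)
  have dA: "(dist A (pt t))\<^sup>2 = ((real c)\<^sup>2 * J)\<^sup>2 - t * (2 * c + b - t) * (real a * J)\<^sup>2" for t :: real
  proof -
    define m where "m = 2 * real c + real b"
    have m: "m \<noteq> 0" using pos by (simp add: m_def)
    have "pt t = B + (t / m) *\<^sub>R (C - B)" by (simp add: pt_def e_def m_def)
    then have "(dist A (pt t))\<^sup>2 = (1 - t / m) * ((real c)\<^sup>2 * J)\<^sup>2 + t / m * ((real c)\<^sup>2 * J)\<^sup>2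
      - t / m * (1 - t / m) * (m * real a * J)\<^sup>2"
      using stewart[of A B "t / m" C] AB AC BC by (simp add: power2_eq_square m_def)
    also have "\<dots> = ((real c)\<^sup>2 * J)\<^sup>2 - t * (m - t) * (real a * J)\<^sup>2"
      using m by (simp add: field_simps power2_eq_square)
    finally show ?thesis by (simp add: m_def)
  qed
  have AD: "dist A D = real b * c * J"
  proof (rule power2_eq_imp_eq)
    show "(dist A D)\<^sup>2 = (real b * c * J)\<^sup>2"
      \<comment> \<open>Up to the factor \<open>J^2\<close>, the value is \<open>c^4 - c * (c + b) *
        a^2 = c^4 - c^2 * (c^2 - b^2) = b^2 * c^2\<close>.\<close>
      unfolding D_def dA power_mult_distrib rel' by (simp add: algebra_simps power2_eq_square)
  qed auto
  have AE: "dist A E = real b * c * J"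
  proof (rule power2_eq_imp_eq)
    show "(dist A E)\<^sup>2 = (real b * c * J)\<^sup>2"
      unfolding E_def dA power_mult_distrib rel' by (simp add: algebra_simps power2_eq_square)
  qed auto
  have AF: "dist A F = real b * b * J"
    using AE pos by (simp add: F_def dist_norm norm_minus_commute)
  have BD: "dist B D = real a * c * J" using dpt[of 0 c] by (simp add: D_def pt_def)
  have DE: "dist D E = real a * b * J" unfolding D_def E_def dpt by simp
  have DF: "dist D F = real a * b * J"
  proof (rule power2_eq_imp_eq)
    have "(dist D F)\<^sup>2 = (1 - b / c) * (real b * c * J)\<^sup>2 + b / c * (real a * b * J)\<^sup>2
      - b / c * (1 - b / c) * (real b * c * J)\<^sup>2"
      using stewart[of D A "b / c" E] AD AE DE by (simp add: F_def dist_commute)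
    also have "\<dots> = (real a * b * J)\<^sup>2"
      using pos unfolding power_mult_distrib rel' by (simp add: field_simps power2_eq_square)
    finally show "(dist D F)\<^sup>2 = (real a * b * J)\<^sup>2" .
  qed auto
  define v w where "v = (1 / real (c * J)) *\<^sub>R (C - A)" and "w = (1 / real (c * J)) *\<^sub>R (E - A)"
  \<comment> \<open>Intercept theorem at \<open>E\<close>: both \<open>EF / EA\<close> and
    \<open>EG / EC\<close> equal \<open>(c - b) / c\<close>.\<close>
  have FG: "G - F = ((real c - real b) / c) *\<^sub>R (C - A)"
  proof -
    have GE: "G = E + (real c - real b) *\<^sub>R e" and CE: "C = E + real c *\<^sub>R e"
      unfolding ptC G_def E_def pt_def by (simp_all flip: scaleR_left_distrib)
    have "G - F = (1 - b / c) *\<^sub>R (E - A) + (real c - real b) *\<^sub>R e"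
      unfolding GE F_def by (simp add: scaleR_diff_left)
    also have "1 - b / c = (real c - real b) / c" using pos by (simp add: field_simps)
    also have "\<dots> *\<^sub>R (E - A) + (real c - real b) *\<^sub>R e = \<dots> *\<^sub>R ((E - A) + real c *\<^sub>R e)"
      using pos by (simp add: scaleR_add_right)
    also have "(E - A) + real c *\<^sub>R e = C - A" unfolding CE by simp
    finally show ?thesis .
  qed
  have c1: "coverable P Q R ((c * J)\<^sup>2) (triangle A B D)"
    using pos AB AD tile BD by (intro coverable_scaled_triangle) (simp_all add: mult_ac)
  have c2: "coverable P Q R ((b * J)\<^sup>2) (triangle A D F)"
    using pos AD AF DF tile by (intro coverable_scaled_triangle) (simp_all add: mult_ac)
  have c3: "coverable P Q R ((a * J)\<^sup>2) (triangle D G F)"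
  proof (intro coverable_scaled_triangle)
    show "dist D G = real (a * J) * dist P Q" using tile by (simp add: D_def G_def dpt mult_ac)
    show "dist D F = real (a * J) * dist P R" using tile DF by simp
    have "dist G F = (real c - real b) / c * (c * c * J)"
      using AC bc by (simp add: dist_norm FG norm_minus_commute)
    also have "\<dots> = (real c * c - b * c) * J" using pos by (simp add: field_simps)
    also have "\<dots> = real (a * J) * real a" using rel' by (simp add: power2_eq_square)
    finally show "dist G F = real (a * J) * dist Q R" using tile by simp
  qed (use pos in simp)
  have c4: "coverable P Q R (2 * ((c - b) * J) * (b * J)) (triangle A H G \<union> triangle A G F)"
  proof (intro coverable_scaled_parallelogram)
    show "norm v = dist P Q" "norm w = dist P R"
      using AC AE tile pos by (simp_all add: v_def w_def dist_norm norm_minus_commute)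
    \<comment> \<open>The third side of a lattice cell is parallel to \<open>EC\<close>, whose
      length \<open>a * c * J\<close> scales down to \<open>a\<close>.\<close>
    have "v - w = (1 / real (c * J)) *\<^sub>R (C - E)" by (simp add: v_def w_def algebra_simps)
    moreover have "dist C E = real c * a * J" unfolding ptC E_def dpt by simp
    ultimately show "norm (v - w) = dist Q R" using pos tile by (simp add: dist_norm)
    show "H = A + real ((c - b) * J) *\<^sub>R v" using pos bc by (simp add: H_def v_def of_nat_diff)
    show "F = A + real (b * J) *\<^sub>R w" using pos by (simp add: F_def w_def)
    have "F + H - A = F + (G - F)" unfolding FG H_def by simp
    then show "G = H + F - A" by (simp add: algebra_simps)
  qed (use pos bc in simp_all)
  have c5: "coverable P Q R ((b * J)\<^sup>2) (triangle H C G)"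
  proof (intro coverable_scaled_triangle)
    have "C - H = (b / c) *\<^sub>R (C - A)"
    proof -
      have "1 - (real c - real b) / c = b / c" using pos by (simp add: field_simps)
      moreover have "C - H = (1 - (real c - real b) / c) *\<^sub>R (C - A)"
        by (simp add: H_def algebra_simps)
      ultimately show ?thesis by (simp only:)
    qed
    then show "dist H C = real (b * J) * dist P Q"
      using AC tile pos by (simp add: dist_norm norm_minus_commute)
    have "H - G = A - F" using FG by (simp add: H_def algebra_simps)
    then show "dist H G = real (b * J) * dist P R" using AF tile by (simp add: dist_norm)
    show "dist C G = real (b * J) * dist Q R" unfolding ptC G_def dpt using tile by simp
  qed (use pos in simp)
  have s1: "triangle A B C = triangle A B D \<union> triangle A D C"
    using closed_segment_line[of 0 c "2 * c + b" B e]
    by (intro split_triangle) (simp add: ptC D_def pt_def)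
  have s2: "triangle A D C = triangle A D E \<union> triangle A E C"
    unfolding ptC D_def E_def pt_def by (intro split_triangle closed_segment_line) auto
  have s3: "triangle D A E = triangle D A F \<union> triangle D F E"
    using closed_segment_line[of 0 "b / c" 1 A "E - A"] bc
    by (intro split_triangle) (simp add: F_def)
  have s4: "triangle A E C = triangle A E G \<union> triangle A G C"
    unfolding ptC G_def E_def pt_def using bc by (intro split_triangle closed_segment_line) auto
  have s5: "triangle G A E = triangle G A F \<union> triangle G F E"
    using closed_segment_line[of 0 "b / c" 1 A "E - A"] bc
    by (intro split_triangle) (simp add: F_def)
  \<comment> \<open>As \<open>b < c\<close>, the point \<open>E\<close> lies between
    \<open>D\<close> and \<open>G\<close>; the leftovers \<open>FDE\<close> of \<open>ADE\<close>
    and \<open>FEG\<close> of \<open>AEG\<close> therefore rejoin as \<open>DGF\<close>.\<close>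
  have s6: "triangle F D G = triangle F D E \<union> triangle F E G"
    unfolding D_def G_def E_def pt_def using bc by (intro split_triangle closed_segment_line) auto
  have s7: "triangle G A C = triangle G A H \<union> triangle G H C"
    using closed_segment_line[of 0 "(real c - real b) / c" 1 A "C - A"] bc
    by (intro split_triangle) (simp add: H_def)
  have e3: "triangle A D E = triangle A D F \<union> triangle F D E"
    and e5: "triangle A E G = triangle A G F \<union> triangle F E G"
    and e6: "triangle D G F = triangle F D E \<union> triangle F E G"
    and e7: "triangle A G C = triangle A H G \<union> triangle H C G"
    using s3 s5 s6 s7 by (simp_all add: triangle_def insert_commute)
  have "triangle A B C = triangle A B D \<union> triangle A D F \<union> triangle D G F \<union>
    (triangle A H G \<union> triangle A G F) \<union> triangle H C G"
    unfolding s1 s2 s4 e3 e5 e6 e7 by (simp only: Un_ac)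
  then show ?thesis using c1 c2 c3 c4 c5 by (simp only: coverable_Un)
qed

section \<open>Angles from side lengths\<close>

lemma vertex_angle_SSS:
  "vertex_angle P Q R =
    arccos (((dist Q P)\<^sup>2 + (dist Q R)\<^sup>2 - (dist P R)\<^sup>2) / (2 * dist Q P * dist Q R))"
proof -
  have "(P - Q) \<bullet> (R - Q) = ((dist Q P)\<^sup>2 + (dist Q R)\<^sup>2 - (dist P R)\<^sup>2) / 2"
    unfolding dot_norm_neg by (simp add: dist_norm norm_minus_commute)
  then show ?thesis unfolding vertex_angle_def
    by (simp only: dist_norm norm_minus_commute[of P Q] norm_minus_commute[of Q R] mult.assoc
        divide_divide_eq_left)
qed

text \<open>Cauchy-Schwarz, or division by zero giving 0 in the degenerate case. It places the
  cosine where \<open>arccos\<close> is injective, so equal angles give equal quotients.\<close>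

lemma cosine_rule_bound:
  fixes P Q R :: "'a::real_inner"
  shows "\<bar>((dist Q P)\<^sup>2 + (dist Q R)\<^sup>2 - (dist P R)\<^sup>2) / (2 * dist Q P * dist Q R)\<bar> \<le> 1"
proof (cases "P = Q \<or> R = Q")
  case False
  have eq: "(P - Q) \<bullet> (R - Q) = ((dist Q P)\<^sup>2 + (dist Q R)\<^sup>2 - (dist P R)\<^sup>2) / 2"
    unfolding dot_norm_neg by (simp add: dist_norm norm_minus_commute)
  have "\<bar>(P - Q) \<bullet> (R - Q)\<bar> \<le> dist Q P * dist Q R"
    using Cauchy_Schwarz_ineq2[of "P - Q" "R - Q"] by (simp add: dist_norm norm_minus_commute)
  then show ?thesis using False unfolding eq by (simp add: abs_mult divide_simps)
qed auto

text \<open>With \<open>sin x = s / 2\<close> the double and triple angle formulas identify the two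
  angles as \<open>2 * x\<close> and \<open>pi / 2 - 3 * x\<close>.\<close>

lemma three_alpha_two_beta:
  fixes s :: real
  assumes "0 < s" "s < 1"
  shows "3 * arccos (1 - s\<^sup>2 / 2) + 2 * arccos ((3 * s - s ^ 3) / 2) = pi"
proof -
  define x where "x = arcsin (s / 2)"
  have sx: "sin x = s / 2" using assms by (simp add: x_def sin_arcsin)
  \<comment> \<open>The bound \<open>x \<le> pi / 6\<close> keeps \<open>pi / 2 - 3 * x\<close>
    nonnegative, hence in the range of \<open>arccos\<close>.\<close>
  have "arcsin (1 / 2) = pi / 6"
    using arcsin_sin[of "pi / 6"] by (simp add: sin_30)
  then have x: "0 \<le> x" "x \<le> pi / 6"
    using assms arcsin_le_mono[of "s / 2" "1 / 2"] arcsin_le_mono[of 0 "s / 2"]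
    by (simp_all add: x_def)
  have "cos (2 * x) = 1 - s\<^sup>2 / 2"
    by (simp add: cos_double_sin sx power_divide)
  then have al: "arccos (1 - s\<^sup>2 / 2) = 2 * x"
    using arccos_cos[of "2 * x"] x by simp
  have "sin (3 * x) = sin (2 * x + x)" by simp
  also have "\<dots> = 3 * sin x - 4 * sin x ^ 3"
    unfolding sin_add sin_double cos_double_sin
    using sin_cos_squared_add[of x] by algebra
  also have "\<dots> = (3 * s - s ^ 3) / 2" by (simp add: sx power_divide)
  finally have "cos (pi / 2 - 3 * x) = (3 * s - s ^ 3) / 2" by (simp add: cos_diff)
  moreover have "arccos (cos (pi / 2 - 3 * x)) = pi / 2 - 3 * x"
    using x by (intro arccos_cos) auto
  ultimately have "arccos ((3 * s - s ^ 3) / 2) = pi / 2 - 3 * x" by (simp only:)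
  with al show ?thesis by simp
qed

section \<open>Divisibility of \<open>M\<close>\<close>

text \<open>After dividing out \<open>g = gcd a c\<close>, the condition
  \<open>c dvd a\<^sup>2\<close> gives \<open>k dvd g\<close>. The cofactor \<open>h = g / k\<close>
  divides \<open>a\<close> and \<open>c\<close>, and by \<open>rel\<close> also \<open>b\<close>, so
  it is 1.\<close>

lemma tile_parametrisation:
  fixes a b c :: nat
  assumes pos: "a > 0" "c > 0" and gcd: "Gcd {a, b, c} = 1" and dvd: "c dvd a\<^sup>2"
    and rel: "a\<^sup>2 + b * c = c\<^sup>2"
  obtains m k where "coprime m k" "a = k * m" "c = k\<^sup>2" "gcd a c = k"
proof -
  define g where "g = gcd a c"
  have "g > 0" using pos by (simp add: g_def)
  obtain m k where m: "a = g * m" and k: "c = g * k" and cop: "coprime m k"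
    using gcd_coprime_exists[of a c] \<open>g > 0\<close> unfolding g_def by (metis mult.commute less_not_refl)
  have "g * k dvd g * (g * m\<^sup>2)" using dvd unfolding m k by (simp add: power2_eq_square mult_ac)
  then have "k dvd g * m\<^sup>2" using \<open>g > 0\<close> by simp
  then have "k dvd g" using cop by (simp add: coprime_dvd_mult_left_iff coprime_commute)
  then obtain h where h: "g = k * h" by (elim dvdE)
  have "k > 0" "h > 0" using \<open>g > 0\<close> unfolding h by simp_all
  have "(k * h * k) * (h * m\<^sup>2 + b) = (k * h * k) * (h * k\<^sup>2)"
    using rel unfolding m k h by (simp add: power2_eq_square algebra_simps)
  then have "h * m\<^sup>2 + b = h * k\<^sup>2" using \<open>k > 0\<close> \<open>h > 0\<close> by simp
  then have "h dvd b" by (metis dvd_add_right_iff dvd_triv_left)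
  then have "h dvd Gcd {a, b, c}" unfolding m k h by (intro Gcd_greatest) auto
  then have "h dvd 1" by (simp only: gcd)
  then have "h = 1" by simp
  then show ?thesis
    using that[of m k] cop m k h g_def by (simp add: power2_eq_square)
qed

text \<open>Modulo \<open>d = k + m\<close> the factor \<open>3 * k\<^sup>2 - m\<^sup>2\<close> is
  \<open>2 * k\<^sup>2\<close>, so it shares at most a factor 2 with \<open>d\<close>. Hence
  \<open>d\<^sup>2\<close> divides \<open>2 * M\<^sup>2\<close>, and 2 is squarefree.\<close>

lemma sum_dvd_if_square_dvd:
  fixes k m M :: int
  assumes cop: "coprime m k" and dvd: "(k + m)\<^sup>2 dvd M\<^sup>2 * (3 * k\<^sup>2 - m\<^sup>2)"
    and nz: "k + m \<noteq> 0"
  shows "k + m dvd M"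
proof -
  define d X where "d = k + m" and "X = 3 * k\<^sup>2 - m\<^sup>2"
  have two: "gcd d X dvd 2"
  proof -
    have "X = 2 * k\<^sup>2 + d * (k - m)" by (simp add: X_def d_def algebra_simps power2_eq_square)
    then have "gcd d X dvd 2 * k\<^sup>2"
      by (metis dvd_add_left_iff dvd_mult2 gcd_dvd1 gcd_dvd2)
    moreover have "coprime d k"
      using cop unfolding d_def coprime_iff_gcd_eq_1 gcd.commute[of _ k] by simp
    then have "coprime (gcd d X) (k\<^sup>2)" by (meson coprime_divisors coprime_power_right_iff dvd_refl gcd_dvd1)
    ultimately show ?thesis by (simp add: coprime_dvd_mult_left_iff)
  qed
  have odd1: "coprime d Y" if "Y dvd X" "odd Y" for Y
  proof -
    have "gcd d Y dvd 2" using two that(1) by (meson dvd_trans gcd_dvd1 gcd_dvd2 gcd_greatest)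
    moreover have "coprime (gcd d Y) 2" using that(2)
      by (meson coprime_divisors coprime_right_2_iff_odd dvd_refl gcd_dvd2)
    ultimately have "is_unit (gcd d Y)" using coprime_common_divisor dvd_refl by blast
    then show ?thesis by (simp only: is_unit_gcd)
  qed
  have "d\<^sup>2 dvd 2 * M\<^sup>2"
  proof (cases "even X")
    case False
    then have "coprime (d\<^sup>2) X" using odd1[of X] by simp
    moreover have "d\<^sup>2 dvd M\<^sup>2 * X" using dvd by (simp add: d_def X_def)
    ultimately show ?thesis by (simp add: coprime_dvd_mult_left_iff)
  next
    case True
    \<comment> \<open>Two odd squares make \<open>X\<close> congruent to 2 modulo 4, so only a
      single factor 2 has to be moved over to \<open>M\<^sup>2\<close>.\<close>
    then have "odd k" "odd m" using cop coprime_common_divisor[of m k 2] by (auto simp: X_def)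
    then obtain i j where "k = 2 * i + 1" "m = 2 * j + 1" by (elim oddE)
    define Y where "Y = 2 * (3 * i\<^sup>2 + 3 * i - j\<^sup>2 - j) + 1"
    have Y: "X = 2 * Y" "odd Y"
      using \<open>k = 2 * i + 1\<close> \<open>m = 2 * j + 1\<close>
      by (simp_all add: X_def Y_def power2_eq_square algebra_simps)
    then have "coprime (d\<^sup>2) Y" using odd1[of Y] by simp
    moreover have "d\<^sup>2 dvd (2 * M\<^sup>2) * Y" using dvd Y by (simp add: d_def X_def mult_ac)
    ultimately show ?thesis by (simp add: coprime_dvd_mult_left_iff)
  qed
  \<comment> \<open>Cancelling the common part of \<open>d\<close> and \<open>M\<close> leaves a
    square dividing 2, so the remaining factor of \<open>d\<close> is a unit.\<close>
  define g where "g = gcd d M"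
  have "g \<noteq> 0" using nz by (simp add: g_def d_def)
  obtain d' M' where d': "d = d' * g" and M': "M = M' * g" and c': "coprime d' M'"
    using gcd_coprime_exists[of d M] \<open>g \<noteq> 0\<close> unfolding g_def by metis
  have "d'\<^sup>2 * g\<^sup>2 dvd (2 * M'\<^sup>2) * g\<^sup>2"
    using \<open>d\<^sup>2 dvd 2 * M\<^sup>2\<close> unfolding d' M' by (simp add: power_mult_distrib mult_ac)
  then have "d'\<^sup>2 dvd 2 * M'\<^sup>2" using \<open>g \<noteq> 0\<close> by simp
  then have "d'\<^sup>2 dvd 2" using c' by (simp add: coprime_dvd_mult_left_iff)
  then have "d'\<^sup>2 \<le> 2" by (rule zdvd_imp_le) simp
  then have "\<not> 2 \<le> \<bar>d'\<bar>" using power_mono[of 2 "\<bar>d'\<bar>" 2] by auto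
  moreover have "d' \<noteq> 0" using nz d' by (auto simp: d_def)
  ultimately have "d' = 1 \<or> d' = - 1" by linarith
  then have "d dvd M" using d' M' by auto
  then show ?thesis by (simp only: d_def)
qed

section \<open>Side lengths of \<open>ABC\<close> from its angles and area\<close>

theorem theorem16:
  fixes N M a b c :: nat and s :: real and P Q R :: "real^2"
  assumes "N > 0" and "M > 0" and "0 < s" and "s < 1"
    and "real N / (real M)\<^sup>2 = (3 - s\<^sup>2) / (1 + s)\<^sup>2"
    and "a > 0" and "b > 0" and "c > 0" and "Gcd {a, b, c} = 1"
    and "s = real a / real c" and "c dvd a\<^sup>2"
    and "real b = real c - (real a)\<^sup>2 / real c"
    and "dist Q R = real a" and "dist R P = real b" and "dist P Q = real c"
  shows "3 * vertex_angle Q P R + 2 * vertex_angle P Q R = pi \<and>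
    (a + c dvd M \<longleftrightarrow> gcd a c dvd M) \<and>
    (\<forall>A B C :: real^2.
       \<not> collinear {A, B, C} \<longrightarrow>
       dist A B = dist A C \<longrightarrow>
       vertex_angle A B C = vertex_angle P Q R \<longrightarrow>
       vertex_angle A C B = vertex_angle P Q R \<longrightarrow>
       measure lebesgue (triangle A B C) = real N * measure lebesgue (triangle P Q R) \<longrightarrow>
       a + c dvd M \<longrightarrow>
       (\<exists>\<T>. tiling N (triangle A B C) (triangle P Q R) \<T>))"
proof (intro conjI allI impI)
  note pos = \<open>a > 0\<close> \<open>b > 0\<close> \<open>c > 0\<close>
  have s: "s = real a / real c" by fact
  have relr: "(real a)\<^sup>2 = real c * (real c - real b)"
    using assms(12) pos by (simp add: field_simps power2_eq_square)
  then have "real (a\<^sup>2 + b * c) = real (c\<^sup>2)" by (simp add: algebra_simps power2_eq_square)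
  then have rel: "a\<^sup>2 + b * c = c\<^sup>2" by (simp only: of_nat_eq_iff)
  have "real N * (1 + s)\<^sup>2 = (real M)\<^sup>2 * (3 - s\<^sup>2)"
    using assms(2,3,5) by (simp add: field_simps)
  then have "real N * ((1 + s) * c)\<^sup>2 = (real M)\<^sup>2 * ((3 - s\<^sup>2) * (real c)\<^sup>2)"
    by (simp add: power_mult_distrib)
  moreover have "(1 + s) * c = real a + c" "(3 - s\<^sup>2) * (real c)\<^sup>2 = 3 * (real c)\<^sup>2 - (real a)\<^sup>2"
    using pos by (simp_all add: s field_simps)
  ultimately have NM: "real N * (real a + c)\<^sup>2 = (real M)\<^sup>2 * (3 * (real c)\<^sup>2 - (real a)\<^sup>2)" by simp
  have tile: "dist P Q = real c" "dist P R = real b" "dist Q R = real a"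
    using assms(13-15) by (simp_all add: dist_commute)

  show "3 * vertex_angle Q P R + 2 * vertex_angle P Q R = pi"
  proof -
    \<comment> \<open>Up to the scale \<open>c\<close> the tile has sides \<open>s\<close>,
      \<open>1 - s\<^sup>2\<close>, \<open>1\<close>, so its cosines are polynomials in
      \<open>s\<close>.\<close>
    have sc: "real a = s * c" "real b = (1 - s\<^sup>2) * c"
      using pos assms(12) by (simp_all add: s left_diff_distrib power2_eq_square)
    have s2: "0 < 1 - s\<^sup>2" using assms(3,4) by (simp add: power_less_one_iff abs_square_less_1)
    have "((real c)\<^sup>2 + (real b)\<^sup>2 - (real a)\<^sup>2) / (2 * real c * real b) = 1 - s\<^sup>2 / 2"
      using s2 pos unfolding sc by (simp add: field_simps power2_eq_square)
    moreover have "((real c)\<^sup>2 + (real a)\<^sup>2 - (real b)\<^sup>2) / (2 * real c * real a) = (3 * s - s ^ 3) / 2"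
      using assms(3) pos unfolding sc by (simp add: field_simps power2_eq_square power3_eq_cube)
    ultimately have "vertex_angle Q P R = arccos (1 - s\<^sup>2 / 2)"
      "vertex_angle P Q R = arccos ((3 * s - s ^ 3) / 2)"
      unfolding vertex_angle_SSS dist_commute[of Q P] tile by (simp_all only:)
    then show ?thesis using three_alpha_two_beta[OF assms(3,4)] by (simp only:)
  qed

  obtain m k where mk: "coprime m k" "a = k * m" "c = k\<^sup>2" and g: "gcd a c = k"
    using tile_parametrisation[OF pos(1,3) assms(9,11) rel] by blast
  show "a + c dvd M \<longleftrightarrow> gcd a c dvd M"
  proof -
    have k: "k > 0" using mk pos by (cases k) auto
    \<comment> \<open>Both sides of \<open>NM\<close> carry \<open>k\<^sup>2\<close>, because
      \<open>a + c = k * (k + m)\<close> and \<open>3 * c\<^sup>2 - a\<^sup>2 = k\<^sup>2 * (3 *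
      k\<^sup>2 - m\<^sup>2)\<close>.\<close>
    have "(real k)\<^sup>2 * (real N * (real k + m)\<^sup>2) = (real k)\<^sup>2 * ((real M)\<^sup>2 * (3 * (real k)\<^sup>2 - (real m)\<^sup>2))"
      using NM unfolding mk by (simp add: algebra_simps power2_eq_square)
    then have "real N * (real k + m)\<^sup>2 = (real M)\<^sup>2 * (3 * (real k)\<^sup>2 - (real m)\<^sup>2)"
      using k by simp
    then have "real_of_int (int N * (int k + int m)\<^sup>2) = real_of_int ((int M)\<^sup>2 * (3 * (int k)\<^sup>2 - (int m)\<^sup>2))"
      by simp
    then have "int N * (int k + int m)\<^sup>2 = (int M)\<^sup>2 * (3 * (int k)\<^sup>2 - (int m)\<^sup>2)"
      by (simp only: of_int_eq_iff)
    then have "(int k + int m)\<^sup>2 dvd (int M)\<^sup>2 * (3 * (int k)\<^sup>2 - (int m)\<^sup>2)"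
      by (metis dvd_triv_right)
    then have "int k + int m dvd int M"
      using mk(1) k by (intro sum_dvd_if_square_dvd) auto
    then have "k + m dvd M" by (metis int_dvd_int_iff of_nat_add)
    moreover have "coprime k (k + m)" using mk(1) unfolding coprime_iff_gcd_eq_1 by (simp add: gcd.commute)
    moreover have "a + c = k * (k + m)" unfolding mk by (simp add: power2_eq_square algebra_simps)
    \<comment> \<open>Since \<open>k + m\<close> divides \<open>M\<close> and is coprime to
      \<open>k\<close>, only the factor \<open>k\<close> of \<open>a + c\<close> remains to be
      tested.\<close>
    ultimately show ?thesis unfolding g by (metis divides_mult dvd_mult_left)
  qed

  fix A B C :: "real^2"
  assume nc: "\<not> collinear {A, B, C}" and iso: "dist A B = dist A C"
    and angle: "vertex_angle A B C = vertex_angle P Q R"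
    and area: "measure lebesgue (triangle A B C) = real N * measure lebesgue (triangle P Q R)"
    and "a + c dvd M"
  then obtain J where J: "M = (a + c) * J" by (elim dvdE)
  then have J0: "J > 0" using \<open>M > 0\<close> by (cases J) auto
  define x y where "x = dist A B" and "y = dist B C"
  have xy: "x > 0" "y > 0" using nc by (auto simp: x_def y_def)
  \<comment> \<open>Sixteen times the squared tile area, with \<open>a\<^sup>2\<close> eliminated
    through \<open>relr\<close>.\<close>
  define K where "K = (real b)\<^sup>2 * (real c - b) * (3 * real c + b)"
  have "0 < real c * (real c - real b)" using pos by (simp flip: relr)
  then have bc: "real b < real c" by (simp add: zero_less_mult_iff)
  have K: "K > 0" using pos bc by (simp add: K_def)
  have tile_area: "16 * (measure lebesgue (triangle P Q R))\<^sup>2 = K"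
    unfolding measure_triangle tile relr K_def by (simp add: algebra_simps power2_eq_square)
  then have "measure lebesgue (triangle P Q R) \<noteq> 0" using K by auto
  then have tile_pos: "measure lebesgue (triangle P Q R) > 0"
    using measure_nonneg[of lebesgue "triangle P Q R"] by linarith
  have N: "real N = (3 * (real c)\<^sup>2 - (real a)\<^sup>2) * (real J)\<^sup>2"
  proof -
    have "(real a + c)\<^sup>2 * real N = (real a + c)\<^sup>2 * ((3 * (real c)\<^sup>2 - (real a)\<^sup>2) * (real J)\<^sup>2)"
      using NM unfolding J by (simp add: algebra_simps power2_eq_square)
    then show ?thesis using pos by (simp add: add_pos_pos)
  qed
  have y: "y = real a * (2 * real c + real b) / (real c)\<^sup>2 * x"
  proof -
    \<comment> \<open>Both sides are the cosine of the base angle, so the base is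
      \<open>2 * x\<close> times the cosine of the tile's \<beta>.\<close>
    have "(x\<^sup>2 + y\<^sup>2 - x\<^sup>2) / (2 * x * y) = ((real c)\<^sup>2 + (real a)\<^sup>2 - (real b)\<^sup>2) / (2 * real c * real a)"
      using angle cosine_rule_bound[of B A C] cosine_rule_bound[of Q P R] iso tile
      unfolding vertex_angle_SSS x_def y_def by (simp add: dist_commute arccos_eq_iff)
    then have "y / (2 * x) = ((real c)\<^sup>2 + (real a)\<^sup>2 - (real b)\<^sup>2) / (2 * real c * real a)"
      using xy by (simp add: power2_eq_square)
    also have "\<dots> = real a * (2 * real c + real b) / (2 * (real c)\<^sup>2)"
    proof -
      have "((real c)\<^sup>2 + (real a)\<^sup>2 - (real b)\<^sup>2) * c = (real a)\<^sup>2 * (2 * real c + real b)"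
        unfolding relr by (simp add: algebra_simps power2_eq_square)
      then have "(real c)\<^sup>2 + (real a)\<^sup>2 - (real b)\<^sup>2 = (real a)\<^sup>2 * (2 * real c + real b) / real c"
        using pos by (simp add: eq_divide_eq)
      then show ?thesis using pos by (simp only:) (simp add: power2_eq_square)
    qed
    finally have "y / (2 * x) * (2 * x) = real a * (2 * real c + real b) / (2 * (real c)\<^sup>2) * (2 * x)"
      by (simp only:)
    then show ?thesis using xy(1) by simp
  qed
  \<comment> \<open>The angles fix the shape up to the scale \<open>t\<close>; the area must show
    that \<open>t = J\<close>.\<close>
  define t where "t = x / (real c)\<^sup>2"
  have xt: "x = (real c)\<^sup>2 * t" and yt: "y = real a * (2 * real c + real b) * t"
    using pos y by (simp_all add: t_def)
  \<comment> \<open>Heron's formula involves the squared area, which is of degree four in the scale;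
    positivity later removes the power.\<close>
  have "t ^ 4 = real J ^ 4"
  proof -
    have "y\<^sup>2 * (4 * x\<^sup>2 - y\<^sup>2) = 16 * (measure lebesgue (triangle A B C))\<^sup>2"
      unfolding measure_triangle using iso by (simp add: x_def y_def algebra_simps power2_eq_square)
    also have "\<dots> = (real N)\<^sup>2 * K"
      unfolding area tile_area[symmetric] by (simp add: power_mult_distrib)
    also have "real N = real c * (2 * real c + real b) * (real J)\<^sup>2"
      unfolding N relr by (simp add: algebra_simps power2_eq_square)
    finally have "(real a)\<^sup>2 * (2 * real c + real b)\<^sup>2 * (4 * (real c) ^ 4 - (real a)\<^sup>2 * (2 * real c + real b)\<^sup>2) * t ^ 4 =
      (real c)\<^sup>2 * (2 * real c + real b)\<^sup>2 * K * real J ^ 4"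
      unfolding xt yt by (simp add: algebra_simps power2_eq_square power4_eq_xxxx)
    moreover have "(real a)\<^sup>2 * (2 * real c + real b)\<^sup>2 * (4 * (real c) ^ 4 - (real a)\<^sup>2 * (2 * real c + real b)\<^sup>2) =
      (real c)\<^sup>2 * (2 * real c + real b)\<^sup>2 * K"
      unfolding relr K_def by (simp add: algebra_simps power2_eq_square power4_eq_xxxx)
    ultimately show ?thesis using pos K by simp
  qed
  then have "t = real J" using xy pos by (intro power_eq_imp_eq_base[of t 4]) (simp_all add: t_def)
  then have sides: "dist A B = real (c * c * J)" "dist A C = real (c * c * J)"
    "dist B C = real ((2 * c + b) * a * J)"
    using xt yt iso by (simp_all add: x_def y_def power2_eq_square)
  \<comment> \<open>Up to \<open>J\<^sup>2\<close> the five counts add up to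
    \<open>c\<^sup>2 + a\<^sup>2 + 2 * b * c\<close>, which is
    \<open>3 * c\<^sup>2 - a\<^sup>2\<close> by \<open>relr\<close>.\<close>
  have "real N = real ((c * J)\<^sup>2 + (b * J)\<^sup>2 + (a * J)\<^sup>2 + 2 * ((c - b) * J) * (b * J) + (b * J)\<^sup>2)"
    using bc unfolding N of_nat_add of_nat_power of_nat_mult power_mult_distrib relr
    by (simp add: of_nat_diff algebra_simps power2_eq_square)
  then have "N = (c * J)\<^sup>2 + (b * J)\<^sup>2 + (a * J)\<^sup>2 + 2 * ((c - b) * J) * (b * J) + (b * J)\<^sup>2"
    by (simp only: of_nat_eq_iff)
  then have "coverable P Q R N (triangle A B C)"
    using coverable_isosceles[OF pos J0 rel tile sides] by simp
  then show "\<exists>\<T>. tiling N (triangle A B C) (triangle P Q R) \<T>"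
    using tile_pos area by (rule tiling_if_coverable)
qed

end
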